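(* Let $n\ge 1$. The algebra map $\mathbb{Z}_2\langle x_1,\dots,x_n,y_1,\dots,y_n\rangle \to \mathrm{End}_{\mathbb{Z}_2}(\mathbb{Z}_2[\mathbb{A}^n])$ sending $x_i$ to the operator of multiplication by $x_i$, and $y_i$ to the Boolean partial derivative $\partial_i$, descends to an isomorphism $\mathrm{BW}_n\to \mathrm{End}_{\mathbb{Z}_2}(\mathbb{Z}_2[\mathbb{A}^n])$ of $\mathbb{Z}_2$-algebras.
   Context: $\mathbb{Z}_2=\{0,1\}$ is the field with two elements and $[n]=\{1,\dots,n\}$. $\mathbb{Z}_2[\mathbb{A}^n]$ is the $\mathbb{Z}_2$-algebra (pointwise operations) of regular functions on $\mathbb{Z}_2^n$, i.e. maps $f:\mathbb{Z}_2^n\to\mathbb{Z}_2$ given by evaluating some polynomial in $\mathbb{Z}_2[x_1,\dots,x_n]$; $x_i$ also denotes the $i$-th coordinate function. The Boolean partial derivative is $\partial_i f(x)=f(x+e_i)+f(x)$, where $e_i\in\mathbb{Z}_2^n$ is the vector whose only nonzero entry is at position $i$. $\mathrm{End}_{\mathbb{Z}_2}$ denotes the algebra of $\mathbb{Z}_2$-linear endomorphisms with composition as product. $\mathbb{Z}_2\langle x_1,\dots,x_n,y_1,\dots,y_n\rangle$ is the free associative $\mathbb{Z}_2$-algebra on the indicated generators. The Boole-Weyl algebra $\mathrm{BW}_n$ is its quotient by the two-sided ideal generated by $x_i^2+x_i$, $y_i^2$, $y_ix_i+x_iy_i+y_i+1$ for $i\in[n]$; $x_ix_j+x_jx_i$,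 $y_iy_j+y_jy_i$ for $i,j\in[n]$; and $y_ix_j+x_jy_i$ for $i\neq j\in[n]$. *)

theory Defs
  imports
    "HOL-Algebra.QuotRing"
    "HOL-Algebra.Module"
    "HOL-Library.Poly_Mapping"
    "HOL-Library.Z2"
    "HOL-Analysis.Finite_Cartesian_Product"
begin

section \<open>Associative algebras\<close>

text \<open>
  The locale \<^locale>\<open>algebra\<close> of the library requires the multiplication to be
  commutative, so the not necessarily commutative notion is introduced here.
\<close>

locale assoc_algebra = Module.module K A + ring A for K and A (structure) +
  assumes smult_mult_left:
      "\<lbrakk>c \<in> carrier K; x \<in> carrier A; y \<in> carrier A\<rbrakk> \<Longrightarrow> (c \<odot> x) \<otimes> y = c \<odot> (x \<otimes> y)"
    and smult_mult_right:
      "\<lbrakk>c \<in> carrier K; x \<in> carrier A; y \<in> carrier A\<rbrakk> \<Longrightarrow> x \<otimes> (c \<odot> y) = c \<odot> (x \<otimes> y)"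

definition algebra_hom ::
    "('k, 'm) ring_scheme \<Rightarrow> ('k, 'a, 'r) module_scheme \<Rightarrow> ('k, 'b, 's) module_scheme \<Rightarrow> ('a \<Rightarrow> 'b) set"
  where "algebra_hom K A B =
    {h \<in> ring_hom A B. \<forall>c\<in>carrier K. \<forall>a\<in>carrier A. h (c \<odot>\<^bsub>A\<^esub> a) = c \<odot>\<^bsub>B\<^esub> h a}"

definition algebra_iso ::
    "('k, 'm) ring_scheme \<Rightarrow> ('k, 'a, 'r) module_scheme \<Rightarrow> ('k, 'b, 's) module_scheme \<Rightarrow> ('a \<Rightarrow> 'b) set"
  where "algebra_iso K A B = {h \<in> algebra_hom K A B. bij_betw h (carrier A) (carrier B)}"

text \<open>The ring \<^term>\<open>A Quot I\<close> together with the induced scalar multiplication.\<close>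

definition quotient_algebra ::
    "('k, 'a, 'r) module_scheme \<Rightarrow> 'a set \<Rightarrow> ('k, 'a set) module"
  where "quotient_algebra A I =
    \<lparr>carrier = carrier (A Quot I), monoid.mult = monoid.mult (A Quot I), one = one (A Quot I),
     zero = zero (A Quot I), add = add (A Quot I),
     smult = (\<lambda>c S. \<Union>x\<in>S. I +>\<^bsub>A\<^esub> (c \<odot>\<^bsub>A\<^esub> x))\<rparr>"

text \<open>
  Endomorphisms are taken to be extensional, i.e. \<^const>\<open>undefined\<close> outside the carrier,
  so that equality of endomorphisms is equality on the carrier.
\<close>

definition End_algebra ::
    "('k, 'm) ring_scheme \<Rightarrow> ('k, 'a, 'r) module_scheme \<Rightarrow> ('k, 'a \<Rightarrow> 'a) module"
  where "End_algebra K M =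
    \<lparr>carrier = {T \<in> carrier M \<rightarrow>\<^sub>E carrier M.
        (\<forall>f\<in>carrier M. \<forall>g\<in>carrier M. T (f \<oplus>\<^bsub>M\<^esub> g) = T f \<oplus>\<^bsub>M\<^esub> T g) \<and>
        (\<forall>c\<in>carrier K. \<forall>f\<in>carrier M. T (c \<odot>\<^bsub>M\<^esub> f) = c \<odot>\<^bsub>M\<^esub> T f)},
     monoid.mult = (\<lambda>S T. compose (carrier M) S T),
     one = (\<lambda>f\<in>carrier M. f),
     zero = (\<lambda>f\<in>carrier M. \<zero>\<^bsub>M\<^esub>),
     add = (\<lambda>S T. \<lambda>f\<in>carrier M. S f \<oplus>\<^bsub>M\<^esub> T f),
     smult = (\<lambda>c T. \<lambda>f\<in>carrier M. c \<odot>\<^bsub>M\<^esub> T f)\<rparr>"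


section \<open>Free associative algebras\<close>

text \<open>
  Words over an alphabet with concatenation, written additively: the library's convolution
  product on finitely supported functions is then the product of the monoid algebra of words,
  i.e. of the free associative algebra.
\<close>

datatype 'a free_word = Word (letters: "'a list")

instantiation free_word :: (type) monoid_add
begin

definition zero_free_word :: "'a free_word" where "0 = Word []"

definition plus_free_word :: "'a free_word \<Rightarrow> 'a free_word \<Rightarrow> 'a free_word"
  where "u + v = Word (letters u @ letters v)"

instance
  by standard (simp_all add: zero_free_word_def plus_free_word_def)

end

definition type_ring :: "'k::comm_ring_1 ring"
  where "type_ring = \<lparr>carrier = UNIV, monoid.mult = (*), one = 1, zero = 0, add = (+)\<rparr>"

definition free_algebra :: "('k::comm_ring_1, 'a free_word \<Rightarrow>\<^sub>0 'k) module"
  where "free_algebra =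
    \<lparr>carrier = UNIV, monoid.mult = (*), one = 1, zero = 0, add = (+),
     smult = (\<lambda>c p. Poly_Mapping.single 0 c * p)\<rparr>"

definition free_gen :: "'a \<Rightarrow> 'a free_word \<Rightarrow>\<^sub>0 'k::comm_ring_1"
  where "free_gen a = Poly_Mapping.single (Word [a]) 1"


section \<open>Regular functions on affine space\<close>

text \<open>The set \<open>[n]\<close> indexing the coordinates is rendered by a finite type, which is nonempty.\<close>

abbreviation Z2 :: "bit ring" where "Z2 \<equiv> type_ring"

definition poly_eval :: "(('n::finite \<Rightarrow>\<^sub>0 nat) \<Rightarrow>\<^sub>0 'k::comm_ring_1) \<Rightarrow> 'k ^ 'n \<Rightarrow> 'k"
  where "poly_eval p x =
    (\<Sum>m\<in>Poly_Mapping.keys p.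
       Poly_Mapping.lookup p m * (\<Prod>i\<in>UNIV. (x $ i) ^ Poly_Mapping.lookup m i))"

definition regular_functions :: "('k::comm_ring_1, 'k ^ 'n::finite \<Rightarrow> 'k) module"
  where "regular_functions =
    \<lparr>carrier = range poly_eval, monoid.mult = (\<lambda>f g x. f x * g x), one = (\<lambda>x. 1),
     zero = (\<lambda>x. 0), add = (\<lambda>f g x. f x + g x), smult = (\<lambda>c f x. c * f x)\<rparr>"

definition mult_coord :: "'n::finite \<Rightarrow> (bit ^ 'n \<Rightarrow> bit) \<Rightarrow> (bit ^ 'n \<Rightarrow> bit)"
  where "mult_coord i = (\<lambda>f\<in>carrier regular_functions. \<lambda>x. x $ i * f x)"

definition boolean_deriv :: "'n::finite \<Rightarrow> (bit ^ 'n \<Rightarrow> bit) \<Rightarrow> (bit ^ 'n \<Rightarrow> bit)"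
  where "boolean_deriv i = (\<lambda>f\<in>carrier regular_functions. \<lambda>x. f (x + axis i 1) + f x)"


section \<open>The Boole-Weyl algebra\<close>

datatype 'n bw_letter = XL 'n | YL 'n

type_synonym 'n bw_free = "'n bw_letter free_word \<Rightarrow>\<^sub>0 bit"

abbreviation bw_x :: "'n \<Rightarrow> 'n bw_free" where "bw_x i \<equiv> free_gen (XL i)"
abbreviation bw_y :: "'n \<Rightarrow> 'n bw_free" where "bw_y i \<equiv> free_gen (YL i)"

definition bw_relations :: "'n bw_free set"
  where "bw_relations =
    (\<Union>i. {bw_x i ^ 2 + bw_x i, bw_y i ^ 2, bw_y i * bw_x i + bw_x i * bw_y i + bw_y i + 1})
    \<union> (\<Union>i j. {bw_x i * bw_x j + bw_x j * bw_x i, bw_y i * bw_y j + bw_y j * bw_y i})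
    \<union> {bw_y i * bw_x j + bw_x j * bw_y i | i j. i \<noteq> j}"

definition bw_ideal :: "'n bw_free set"
  where "bw_ideal = Idl\<^bsub>(free_algebra :: (bit, 'n bw_free) module)\<^esub> bw_relations"

definition boole_weyl :: "(bit, 'n bw_free set) module"
  where "boole_weyl = quotient_algebra free_algebra bw_ideal"

abbreviation End_regular :: "(bit, (bit ^ 'n::finite \<Rightarrow> bit) \<Rightarrow> (bit ^ 'n \<Rightarrow> bit)) module"
  where "End_regular \<equiv> End_algebra Z2 regular_functions"

definition bw_action :: "('n::finite bw_free \<Rightarrow> (bit ^ 'n \<Rightarrow> bit) \<Rightarrow> (bit ^ 'n \<Rightarrow> bit)) \<Rightarrow> bool"
  where "bw_action \<Phi> \<longleftrightarrow> \<Phi> \<in> algebra_hom Z2 free_algebra End_regular \<and>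
    (\<forall>i. \<Phi> (bw_x i) = mult_coord i) \<and> (\<forall>i. \<Phi> (bw_y i) = boolean_deriv i)"


section \<open>Well-definedness\<close>

text \<open>All structures above are associative algebras, and the operators are endomorphisms.\<close>

lemma assoc_algebraI:
  fixes K and A (structure)
  assumes "cring K" "ring A"
    and "\<And>a x. \<lbrakk>a \<in> carrier K; x \<in> carrier A\<rbrakk> \<Longrightarrow> a \<odot> x \<in> carrier A"
    and "\<And>a b x. \<lbrakk>a \<in> carrier K; b \<in> carrier K; x \<in> carrier A\<rbrakk> \<Longrightarrow>
          (a \<oplus>\<^bsub>K\<^esub> b) \<odot> x = a \<odot> x \<oplus> b \<odot> x"
    and "\<And>a x y. \<lbrakk>a \<in> carrier K; x \<in> carrier A; y \<in> carrier A\<rbrakk> \<Longrightarrow>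
          a \<odot> (x \<oplus> y) = a \<odot> x \<oplus> a \<odot> y"
    and "\<And>a b x. \<lbrakk>a \<in> carrier K; b \<in> carrier K; x \<in> carrier A\<rbrakk> \<Longrightarrow>
          (a \<otimes>\<^bsub>K\<^esub> b) \<odot> x = a \<odot> (b \<odot> x)"
    and "\<And>x. x \<in> carrier A \<Longrightarrow> \<one>\<^bsub>K\<^esub> \<odot> x = x"
    and "\<And>c x y. \<lbrakk>c \<in> carrier K; x \<in> carrier A; y \<in> carrier A\<rbrakk> \<Longrightarrow> (c \<odot> x) \<otimes> y = c \<odot> (x \<otimes> y)"
    and "\<And>c x y. \<lbrakk>c \<in> carrier K; x \<in> carrier A; y \<in> carrier A\<rbrakk> \<Longrightarrow> x \<otimes> (c \<odot> y) = c \<odot> (x \<otimes> y)"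
  shows "assoc_algebra K A"
proof -
  interpret K: cring K by fact
  interpret A: ring A by fact
  show ?thesis
    by unfold_locales (use assms in auto)
qed

lemma cring_type_ring: "cring (type_ring :: 'k::comm_ring_1 ring)"
proof -
  have inv: "\<exists>y. y + x = 0 \<and> x + y = 0" for x :: 'k
    by (rule exI[of _ "- x"]) simp
  have inv': "\<exists>y. x + y = 0" for x :: 'k
    by (rule exI[of _ "- x"]) simp
  show ?thesis
    by unfold_locales (auto simp: type_ring_def algebra_simps Units_def inv inv')
qed

lemma free_algebra_assoc_algebra:
  "assoc_algebra type_ring (free_algebra :: ('k::comm_ring_1, 'a free_word \<Rightarrow>\<^sub>0 'k) module)"
proof (rule assoc_algebraI)
  let ?F = "free_algebra :: ('k, 'a free_word \<Rightarrow>\<^sub>0 'k) module"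
  have inv: "\<exists>y. y + x = 0 \<and> x + y = 0" for x :: "'a free_word \<Rightarrow>\<^sub>0 'k"
    by (rule exI[of _ "- x"]) simp
  have inv': "\<exists>y. x + y = 0" for x :: "'a free_word \<Rightarrow>\<^sub>0 'k"
    by (rule exI[of _ "- x"]) simp
  show "ring ?F"
    by unfold_locales (auto simp: free_algebra_def algebra_simps Units_def inv inv')
  have comm: "p * Poly_Mapping.single 0 c = Poly_Mapping.single 0 c * p" for c and p :: "'a free_word \<Rightarrow>\<^sub>0 'k"
  proof (induction p rule: update_induct)
    case const
    then show ?case by simp
  next
    case (update p k v)
    then have "Poly_Mapping.update k v p = p + Poly_Mapping.single k v"
      by (intro poly_mapping_eqI)
         (auto simp: lookup_update lookup_add lookup_single when_def in_keys_iff)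
    with update show ?case by (simp add: algebra_simps mult_single)
  qed
  fix c and x y :: "'a free_word \<Rightarrow>\<^sub>0 'k"
  show "x \<otimes>\<^bsub>?F\<^esub> (c \<odot>\<^bsub>?F\<^esub> y) = c \<odot>\<^bsub>?F\<^esub> (x \<otimes>\<^bsub>?F\<^esub> y)"
    using comm by (simp add: free_algebra_def mult.assoc[symmetric])
qed (simp_all add: cring_type_ring[unfolded type_ring_def] free_algebra_def type_ring_def distrib_left distrib_right
       single_add mult_single flip: mult.assoc)

lemma (in assoc_algebra) ideal_smult_closed:
  assumes "ideal I A" "c \<in> carrier K" "x \<in> I"
  shows "c \<odot> x \<in> I"
proof -
  interpret I: ideal I A by fact
  have x: "x \<in> carrier A" using I.a_subset assms by auto
  have "c \<odot> x = (c \<odot> \<one>) \<otimes> x" using assms x by (simp add: smult_mult_left)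
  then show ?thesis using I.I_l_closed[of x "c \<odot> \<one>"] assms by simp
qed

lemma (in assoc_algebra) quotient_smult:
  assumes "ideal I A" "c \<in> carrier K" "x \<in> carrier A"
  shows "c \<odot>\<^bsub>quotient_algebra A I\<^esub> (I +> x) = I +> (c \<odot> x)"
proof -
  interpret I: ideal I A by fact
  have "I +> (c \<odot> z) = I +> (c \<odot> x)" if z: "z \<in> I +> x" for z
  proof -
    obtain h where h: "h \<in> I" "z = h \<oplus> x" using z by (auto simp: a_r_coset_def')
    have "h \<in> carrier A" using h I.a_subset by auto
    then have "c \<odot> z = c \<odot> h \<oplus> c \<odot> x" using h assms by (simp add: smult_r_distr)
    moreover have "c \<odot> h \<in> I" using ideal_smult_closed assms h by auto
    ultimately have "c \<odot> z \<in> I +> (c \<odot> x)" by (auto simp: a_r_coset_def')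
    then show ?thesis
      using I.a_repr_independence' assms by (metis smult_closed)
  qed
  moreover have "x \<in> I +> x" using assms I.a_rcos_self by auto
  ultimately have "(\<Union>z\<in>I +> x. I +> (c \<odot> z)) = I +> (c \<odot> x)"
    by (intro SUP_eq_const) blast+
  then show ?thesis by (simp add: quotient_algebra_def)
qed

lemma (in assoc_algebra) quotient_assoc_algebra:
  assumes "ideal I A"
  shows "assoc_algebra K (quotient_algebra A I)"
proof -
  interpret I: ideal I A by fact
  let ?Q = "quotient_algebra A I"
  interpret Q: ring "A Quot I" by (rule I.quotient_is_ring)
  have ringQ: "ring ?Q"
  proof -
    have q: "carrier ?Q = carrier (A Quot I)" "monoid.mult ?Q = monoid.mult (A Quot I)" "add ?Q = add (A Quot I)"
        "\<one>\<^bsub>?Q\<^esub> = \<one>\<^bsub>A Quot I\<^esub>" "\<zero>\<^bsub>?Q\<^esub> = \<zero>\<^bsub>A Quot I\<^esub>"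
      by (simp_all add: quotient_algebra_def)
    show ?thesis
      by (intro ringI abelian_groupI monoidI; unfold q)
         (auto simp: Q.m_assoc Q.l_distr Q.r_distr Q.a_ac intro: Q.a_inv_closed Q.l_neg)
  qed
  have carI: "I +> x \<in> carrier ?Q" if "x \<in> carrier A" for x
    using that by (auto simp: quotient_algebra_def FactRing_simps)
  have carE: thesis if "z \<in> carrier ?Q" "\<And>x. x \<in> carrier A \<Longrightarrow> z = I +> x \<Longrightarrow> thesis" for z thesis
    using that by (auto simp: quotient_algebra_def FactRing_simps)
  have add: "(I +> x) \<oplus>\<^bsub>?Q\<^esub> (I +> y) = I +> (x \<oplus> y)" if "x \<in> carrier A" "y \<in> carrier A" for x y
    using that by (simp add: quotient_algebra_def FactRing_def I.a_rcos_sum)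
  have mul: "(I +> x) \<otimes>\<^bsub>?Q\<^esub> (I +> y) = I +> (x \<otimes> y)" if "x \<in> carrier A" "y \<in> carrier A" for x y
    using that by (simp add: quotient_algebra_def FactRing_def I.rcoset_mult_add)
  note sm = quotient_smult[OF assms]
  show ?thesis
  proof (rule assoc_algebraI[OF R.cring_axioms ringQ])
    show "a \<odot>\<^bsub>?Q\<^esub> z \<in> carrier ?Q" if "a \<in> carrier K" "z \<in> carrier ?Q" for a z
      using that by (auto elim!: carE simp: sm intro!: carI)
    show "\<one>\<^bsub>K\<^esub> \<odot>\<^bsub>?Q\<^esub> z = z" if "z \<in> carrier ?Q" for z
      using that by (auto elim!: carE simp: sm)
    show "(a \<oplus>\<^bsub>K\<^esub> b) \<odot>\<^bsub>?Q\<^esub> z = a \<odot>\<^bsub>?Q\<^esub> z \<oplus>\<^bsub>?Q\<^esub> b \<odot>\<^bsub>?Q\<^esub> z"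
      if "a \<in> carrier K" "b \<in> carrier K" "z \<in> carrier ?Q" for a b z
      using that by (auto elim!: carE simp: sm add smult_l_distr)
    show "(a \<otimes>\<^bsub>K\<^esub> b) \<odot>\<^bsub>?Q\<^esub> z = a \<odot>\<^bsub>?Q\<^esub> (b \<odot>\<^bsub>?Q\<^esub> z)"
      if "a \<in> carrier K" "b \<in> carrier K" "z \<in> carrier ?Q" for a b z
      using that by (auto elim!: carE simp: sm smult_assoc1)
    show "a \<odot>\<^bsub>?Q\<^esub> (z \<oplus>\<^bsub>?Q\<^esub> w) = a \<odot>\<^bsub>?Q\<^esub> z \<oplus>\<^bsub>?Q\<^esub> a \<odot>\<^bsub>?Q\<^esub> w"
      if "a \<in> carrier K" "z \<in> carrier ?Q" "w \<in> carrier ?Q" for a z w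
      using that by (auto elim!: carE simp: sm add smult_r_distr)
    show "(a \<odot>\<^bsub>?Q\<^esub> z) \<otimes>\<^bsub>?Q\<^esub> w = a \<odot>\<^bsub>?Q\<^esub> (z \<otimes>\<^bsub>?Q\<^esub> w)"
      if "a \<in> carrier K" "z \<in> carrier ?Q" "w \<in> carrier ?Q" for a z w
      using that by (auto elim!: carE simp: sm mul smult_mult_left)
    show "z \<otimes>\<^bsub>?Q\<^esub> (a \<odot>\<^bsub>?Q\<^esub> w) = a \<odot>\<^bsub>?Q\<^esub> (z \<otimes>\<^bsub>?Q\<^esub> w)"
      if "a \<in> carrier K" "z \<in> carrier ?Q" "w \<in> carrier ?Q" for a z w
      using that by (auto elim!: carE simp: sm mul smult_mult_right)
  qed
qed

lemma End_assoc_algebra: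
  assumes "Module.module K M"
  shows "assoc_algebra K (End_algebra K M)"
proof -
  interpret M: Module.module K M by fact
  let ?E = "End_algebra K M"
  note defs = End_algebra_def compose_def restrict_def
  have eqI: "S = T" if "S \<in> carrier ?E" "T \<in> carrier ?E" "\<And>f. f \<in> carrier M \<Longrightarrow> S f = T f" for S T
    using that by (intro PiE_ext[of S "carrier M" "\<lambda>_. carrier M"]) (auto simp: End_algebra_def)
  have app: "T f \<in> carrier M" if "T \<in> carrier ?E" "f \<in> carrier M" for T f
    using that by (auto simp: End_algebra_def)
  have T_add: "T (f \<oplus>\<^bsub>M\<^esub> g) = T f \<oplus>\<^bsub>M\<^esub> T g" if "T \<in> carrier ?E" "f \<in> carrier M" "g \<in> carrier M" for T f g
    using that by (auto simp: End_algebra_def)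
  have T_smult: "T (c \<odot>\<^bsub>M\<^esub> f) = c \<odot>\<^bsub>M\<^esub> T f" if "T \<in> carrier ?E" "c \<in> carrier K" "f \<in> carrier M" for T c f
    using that by (auto simp: End_algebra_def)
  have ap: "(S \<otimes>\<^bsub>?E\<^esub> T) f = S (T f)" "(S \<oplus>\<^bsub>?E\<^esub> T) f = S f \<oplus>\<^bsub>M\<^esub> T f" "\<one>\<^bsub>?E\<^esub> f = f"
      "\<zero>\<^bsub>?E\<^esub> f = \<zero>\<^bsub>M\<^esub>" "(c \<odot>\<^bsub>?E\<^esub> T) f = c \<odot>\<^bsub>M\<^esub> T f"
    if "f \<in> carrier M" for S T f c
    using that by (simp_all add: defs)
  have in_E: "T \<in> carrier ?E \<longleftrightarrow> T \<in> extensional (carrier M) \<and>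
      (\<forall>f\<in>carrier M. T f \<in> carrier M) \<and>
      (\<forall>f\<in>carrier M. \<forall>g\<in>carrier M. T (f \<oplus>\<^bsub>M\<^esub> g) = T f \<oplus>\<^bsub>M\<^esub> T g) \<and>
      (\<forall>c\<in>carrier K. \<forall>f\<in>carrier M. T (c \<odot>\<^bsub>M\<^esub> f) = c \<odot>\<^bsub>M\<^esub> T f)" for T
    by (auto simp: End_algebra_def PiE_def)
  have ext: "S \<otimes>\<^bsub>?E\<^esub> T \<in> extensional (carrier M)" "S \<oplus>\<^bsub>?E\<^esub> T \<in> extensional (carrier M)"
      "\<one>\<^bsub>?E\<^esub> \<in> extensional (carrier M)" "\<zero>\<^bsub>?E\<^esub> \<in> extensional (carrier M)"
      "c \<odot>\<^bsub>?E\<^esub> T \<in> extensional (carrier M)" for S T c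
    by (simp_all add: End_algebra_def)
  have mult: "S \<otimes>\<^bsub>?E\<^esub> T \<in> carrier ?E" if "S \<in> carrier ?E" "T \<in> carrier ?E" for S T
    unfolding in_E[of "S \<otimes>\<^bsub>?E\<^esub> T"] using that ext by (auto simp: ap app T_add T_smult)
  have add: "S \<oplus>\<^bsub>?E\<^esub> T \<in> carrier ?E" if "S \<in> carrier ?E" "T \<in> carrier ?E" for S T
    unfolding in_E[of "S \<oplus>\<^bsub>?E\<^esub> T"] using that ext
    by (auto simp: ap app T_add T_smult M.smult_r_distr M.M.a_ac)
  have one: "\<one>\<^bsub>?E\<^esub> \<in> carrier ?E"
    unfolding in_E using ext by (auto simp: ap)
  have zero: "\<zero>\<^bsub>?E\<^esub> \<in> carrier ?E"
    unfolding in_E using ext by (auto simp: ap)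
  have smult: "c \<odot>\<^bsub>?E\<^esub> T \<in> carrier ?E" if "c \<in> carrier K" "T \<in> carrier ?E" for c T
    unfolding in_E[of "c \<odot>\<^bsub>?E\<^esub> T"] using that ext
    by (auto simp: ap app T_add T_smult M.smult_r_distr M.smult_assoc1[symmetric] M.m_comm)
  note cl = mult add one zero smult
  note laws = ap app cl T_add T_smult M.M.a_assoc M.smult_l_distr M.smult_r_distr M.smult_assoc1
  have neg: "\<exists>S\<in>carrier ?E. S \<oplus>\<^bsub>?E\<^esub> T = \<zero>\<^bsub>?E\<^esub>" if "T \<in> carrier ?E" for T
  proof
    show "(\<ominus>\<^bsub>K\<^esub> \<one>\<^bsub>K\<^esub>) \<odot>\<^bsub>?E\<^esub> T \<in> carrier ?E" using that by (simp add: smult)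
    show "((\<ominus>\<^bsub>K\<^esub> \<one>\<^bsub>K\<^esub>) \<odot>\<^bsub>?E\<^esub> T) \<oplus>\<^bsub>?E\<^esub> T = \<zero>\<^bsub>?E\<^esub>"
      by (rule eqI) (use that in \<open>auto simp: laws M.smult_l_minus M.M.l_neg\<close>)
  qed
  have "ring ?E"
    by (intro ringI abelian_groupI monoidI cl neg; assumption?; rule eqI)
       (auto simp: laws M.M.a_ac)
  then show ?thesis
  proof (rule assoc_algebraI[OF M.R.cring_axioms])
    show "(a \<oplus>\<^bsub>K\<^esub> b) \<odot>\<^bsub>?E\<^esub> T = a \<odot>\<^bsub>?E\<^esub> T \<oplus>\<^bsub>?E\<^esub> b \<odot>\<^bsub>?E\<^esub> T"
      if "a \<in> carrier K" "b \<in> carrier K" "T \<in> carrier ?E" for a b T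
      by (rule eqI) (use that in \<open>simp_all add: laws\<close>)
    show "a \<odot>\<^bsub>?E\<^esub> (S \<oplus>\<^bsub>?E\<^esub> T) = a \<odot>\<^bsub>?E\<^esub> S \<oplus>\<^bsub>?E\<^esub> a \<odot>\<^bsub>?E\<^esub> T"
      if "a \<in> carrier K" "S \<in> carrier ?E" "T \<in> carrier ?E" for a S T
      by (rule eqI) (use that in \<open>simp_all add: laws\<close>)
    show "(a \<otimes>\<^bsub>K\<^esub> b) \<odot>\<^bsub>?E\<^esub> T = a \<odot>\<^bsub>?E\<^esub> (b \<odot>\<^bsub>?E\<^esub> T)"
      if "a \<in> carrier K" "b \<in> carrier K" "T \<in> carrier ?E" for a b T
      by (rule eqI) (use that in \<open>simp_all add: laws\<close>)
    show "\<one>\<^bsub>K\<^esub> \<odot>\<^bsub>?E\<^esub> T = T" if "T \<in> carrier ?E" for T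
      by (rule eqI) (use that in \<open>simp_all add: laws\<close>)
    show "(c \<odot>\<^bsub>?E\<^esub> S) \<otimes>\<^bsub>?E\<^esub> T = c \<odot>\<^bsub>?E\<^esub> (S \<otimes>\<^bsub>?E\<^esub> T)"
      if "c \<in> carrier K" "S \<in> carrier ?E" "T \<in> carrier ?E" for c S T
      by (rule eqI) (use that in \<open>simp_all add: laws\<close>)
    show "S \<otimes>\<^bsub>?E\<^esub> (c \<odot>\<^bsub>?E\<^esub> T) = c \<odot>\<^bsub>?E\<^esub> (S \<otimes>\<^bsub>?E\<^esub> T)"
      if "c \<in> carrier K" "S \<in> carrier ?E" "T \<in> carrier ?E" for c S T
      by (rule eqI) (use that in \<open>simp_all add: laws\<close>)
  qed (rule smult)
qed

lemma poly_eval_alt: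
  assumes "finite F" "Poly_Mapping.keys p \<subseteq> F"
  shows "poly_eval p x =
    (\<Sum>m\<in>F. Poly_Mapping.lookup p m * (\<Prod>i\<in>UNIV. (x $ i) ^ Poly_Mapping.lookup m i))"
  unfolding poly_eval_def by (rule sum.mono_neutral_left) (use assms in \<open>auto simp: in_keys_iff\<close>)

lemma poly_eval_add: "poly_eval (p + q) x = poly_eval p x + poly_eval q x"
proof -
  let ?F = "Poly_Mapping.keys p \<union> Poly_Mapping.keys q"
  have "Poly_Mapping.keys (p + q) \<subseteq> ?F" by (rule Poly_Mapping.keys_add)
  then show ?thesis
    by (simp add: poly_eval_alt[of ?F] lookup_add algebra_simps sum.distrib)
qed

lemma poly_eval_single:
  "poly_eval (Poly_Mapping.single m c) x = c * (\<Prod>i\<in>UNIV. (x $ i) ^ Poly_Mapping.lookup m i)"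
  by (simp add: poly_eval_alt[of "{m}"])

lemma poly_eval_mult: "poly_eval (p * q) x = poly_eval p x * poly_eval q x"
proof (induction p rule: update_induct)
  case const
  then show ?case by (simp add: poly_eval_def)
next
  case (update p m c)
  have eq: "Poly_Mapping.update m c p = p + Poly_Mapping.single m c"
    using update by (intro poly_mapping_eqI)
      (auto simp: lookup_update lookup_add lookup_single when_def in_keys_iff)
  have "poly_eval (Poly_Mapping.single m c * q) x = poly_eval (Poly_Mapping.single m c) x * poly_eval q x"
  proof (induction q rule: update_induct)
    case const
    then show ?case by (simp add: poly_eval_def)
  next
    case (update q k d)
    have "Poly_Mapping.update k d q = q + Poly_Mapping.single k d"
      using update by (intro poly_mapping_eqI)
        (auto simp: lookup_update lookup_add lookup_single when_def in_keys_iff)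
    with update show ?case
      by (simp only: distrib_left poly_eval_add mult_single poly_eval_single lookup_add power_add
           prod.distrib mult_ac)
  qed
  with update eq show ?case by (simp add: distrib_right poly_eval_add)
qed

context
  fixes M :: "('k::comm_ring_1, 'k ^ 'n::finite \<Rightarrow> 'k) module"
  defines "M \<equiv> regular_functions"
begin

lemma regular_ops:
  "\<one>\<^bsub>M\<^esub> = (\<lambda>x. 1)" "\<zero>\<^bsub>M\<^esub> = (\<lambda>x. 0)" "f \<oplus>\<^bsub>M\<^esub> g = (\<lambda>x. f x + g x)"
  "f \<otimes>\<^bsub>M\<^esub> g = (\<lambda>x. f x * g x)" "c \<odot>\<^bsub>M\<^esub> f = (\<lambda>x. c * f x)"
  by (simp_all add: M_def regular_functions_def)

lemma regular_const: "(\<lambda>x. c) \<in> carrier M"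
  by (auto simp: M_def regular_functions_def poly_eval_single
      intro!: image_eqI[of _ _ "Poly_Mapping.single 0 c"])

lemma regular_coord: "(\<lambda>x. x $ i) \<in> carrier M"
proof -
  have "(\<Prod>j\<in>UNIV. (x $ j) ^ Poly_Mapping.lookup (Poly_Mapping.single i (Suc 0)) j) = x $ i" for x :: "'k ^ 'n"
  proof -
    have "(\<Prod>j\<in>UNIV. (x $ j) ^ Poly_Mapping.lookup (Poly_Mapping.single i (Suc 0)) j)
        = (\<Prod>j\<in>{i}. (x $ j) ^ Poly_Mapping.lookup (Poly_Mapping.single i (Suc 0)) j)"
      by (rule prod.mono_neutral_right) (auto simp: lookup_single when_def)
    then show ?thesis by simp
  qed
  then show ?thesis
    by (auto simp: M_def regular_functions_def poly_eval_single
        intro!: image_eqI[of _ _ "Poly_Mapping.single (Poly_Mapping.single i 1) 1"])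
qed

lemma regular_add: "f \<in> carrier M \<Longrightarrow> g \<in> carrier M \<Longrightarrow> (\<lambda>x. f x + g x) \<in> carrier M"
  by (auto simp: M_def regular_functions_def simp flip: poly_eval_add)

lemma regular_mult: "f \<in> carrier M \<Longrightarrow> g \<in> carrier M \<Longrightarrow> (\<lambda>x. f x * g x) \<in> carrier M"
  by (auto simp: M_def regular_functions_def simp flip: poly_eval_mult)

lemma regular_power: "f \<in> carrier M \<Longrightarrow> (\<lambda>x. f x ^ k) \<in> carrier M"
  by (induction k) (auto simp: regular_const regular_mult)

lemma regular_prod:
  "finite J \<Longrightarrow> (\<And>j. j \<in> J \<Longrightarrow> f j \<in> carrier M) \<Longrightarrow> (\<lambda>x. \<Prod>j\<in>J. f j x) \<in> carrier M"
  by (induction J rule: finite_induct) (auto simp: regular_const regular_mult)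

lemma regular_sum:
  "finite J \<Longrightarrow> (\<And>j. j \<in> J \<Longrightarrow> f j \<in> carrier M) \<Longrightarrow> (\<lambda>x. \<Sum>j\<in>J. f j x) \<in> carrier M"
  by (induction J rule: finite_induct) (auto simp: regular_const regular_add)

lemma regular_translate:
  assumes "f \<in> carrier M"
  shows "(\<lambda>x. f (x + v)) \<in> carrier M"
proof -
  obtain p where p: "f = poly_eval p" using assms by (auto simp: M_def regular_functions_def)
  have "(\<lambda>x. \<Sum>m\<in>Poly_Mapping.keys p. Poly_Mapping.lookup p m *
      (\<Prod>i\<in>UNIV. (x $ i + v $ i) ^ Poly_Mapping.lookup m i)) \<in> carrier M"
    by (intro regular_sum regular_mult regular_prod regular_power regular_add regular_const
        regular_coord) auto
  then show ?thesis by (simp add: p poly_eval_def)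
qed

lemma regular_functions_assoc_algebra: "assoc_algebra type_ring M"
proof -
  have neg: "\<exists>g\<in>carrier M. (\<lambda>x. g x + f x) = (\<lambda>x. 0)" if "f \<in> carrier M" for f
    by (rule bexI[of _ "\<lambda>x. (- 1) * f x"], simp, rule regular_mult[OF regular_const that])
  have neg': "\<exists>g\<in>carrier M. (\<lambda>x. f x + g x) = (\<lambda>x. 0)" if "f \<in> carrier M" for f
    using neg[OF that] by (simp only: add.commute[of "f _"])
  have "ring M"
    by (intro ringI abelian_groupI monoidI; unfold regular_ops;
        (intro regular_add regular_mult regular_const; assumption)?)
       (simp_all add: regular_const neg neg' add_ac mult_ac distrib_left distrib_right)
  then show ?thesis
    by (rule assoc_algebraI[OF cring_type_ring]; unfold regular_ops;
        (intro regular_mult regular_const; assumption)?)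
       (simp_all add: regular_mult[OF regular_const] type_ring_def mult_ac distrib_left distrib_right)
qed

lemma in_End:
  assumes "\<And>f. f \<in> carrier M \<Longrightarrow> T f \<in> carrier M"
    and "\<And>f g. T (\<lambda>x. f x + g x) = (\<lambda>x. T f x + T g x)"
    and "\<And>c f. T (\<lambda>x. c * f x) = (\<lambda>x. c * T f x)"
  shows "(\<lambda>f\<in>carrier M. T f) \<in> carrier (End_algebra type_ring M)"
  using assms regular_add regular_mult[OF regular_const]
  unfolding End_algebra_def regular_ops by simp

lemma mult_in_End:
  assumes "g \<in> carrier M"
  shows "(\<lambda>f\<in>carrier M. \<lambda>x. g x * f x) \<in> carrier (End_algebra type_ring M)"
  by (rule in_End) (use regular_mult[OF assms] in \<open>simp_all add: distrib_left mult.left_commute\<close>)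

lemma diff_in_End:
  "(\<lambda>f\<in>carrier M. \<lambda>x. f (x + v) + f x) \<in> carrier (End_algebra type_ring M)"
proof (rule in_End)
  show "(\<lambda>x. f (x + v) + f x) \<in> carrier M" if "f \<in> carrier M" for f
    by (rule regular_add[OF regular_translate[OF that] that])
qed (simp_all add: distrib_left add_ac)

end

lemma mult_coord_in_End: "mult_coord i \<in> carrier End_regular"
  unfolding mult_coord_def by (rule mult_in_End[OF regular_coord])

lemma boolean_deriv_in_End: "boolean_deriv i \<in> carrier End_regular"
  unfolding boolean_deriv_def by (rule diff_in_End)

lemma ideal_bw_ideal: "ideal bw_ideal (free_algebra :: (bit, 'n bw_free) module)"
proof -
  interpret assoc_algebra type_ring "free_algebra :: (bit, 'n bw_free) module"
    by (rule free_algebra_assoc_algebra)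
  show ?thesis
    unfolding bw_ideal_def by (rule genideal_ideal) (simp add: free_algebra_def)
qed

lemma boole_weyl_assoc_algebra: "assoc_algebra Z2 (boole_weyl :: (bit, 'n bw_free set) module)"
  unfolding boole_weyl_def
  by (rule assoc_algebra.quotient_assoc_algebra[OF free_algebra_assoc_algebra ideal_bw_ideal])

end

theory Submission
  imports Defs
begin

text \<open>
  Every function \<open>\<int>\<^sub>2\<^sup>n \<rightarrow> \<int>\<^sub>2\<close> is regular, because a finite set over a field is cut out point by point,
  so the endomorphism algebra is a full matrix algebra whose rows and columns are indexed by
  \<open>\<int>\<^sub>2\<^sup>n\<close>. The proof finds its matrix units inside the Boole-Weyl algebra.

  In characteristic two the element \<open>s\<^sub>i = y\<^sub>i + 1\<close> acts as the translation \<open>f(x) \<mapsto> f(x + e\<^sub>i)\<close>. In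
  terms of \<open>x\<^sub>i\<close> and \<open>s\<^sub>i\<close> the relations say that the \<open>x\<^sub>i\<close> are commuting idempotents, that the \<open>s\<^sub>i\<close>
  are commuting involutions, and that \<open>s\<^sub>i x\<^sub>i = (x\<^sub>i + 1) s\<^sub>i\<close>, while \<open>s\<^sub>i\<close> and \<open>x\<^sub>j\<close> commute for \<open>i \<noteq> j\<close>:
  the algebra is the crossed product of the functions with the group of translations.
  Let \<open>D\<^sub>u\<close> be the product of the factors \<open>x\<^sub>i + u\<^sub>i + 1\<close>, which acts as multiplication by the
  indicator of the point \<open>u\<close>, and let \<open>S\<^sub>v\<close> be the product of the \<open>s\<^sub>i\<close> with \<open>v\<^sub>i = 1\<close>, which acts as
  translation by \<open>v\<close>. Then \<open>E\<^sub>u\<^sub>w = D\<^sub>u S\<^sub>u\<^sub>+\<^sub>w\<close> acts as the matrix unit sending the indicator of \<open>w\<close>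
  to that of \<open>u\<close> (\<open>bw_rep_matrix_unit\<close>). Surjectivity follows.

  For injectivity, the relations alone give \<open>x\<^sub>i E\<^sub>u\<^sub>w = u\<^sub>i E\<^sub>u\<^sub>w\<close> and \<open>s\<^sub>i E\<^sub>u\<^sub>w = E\<^sub>v\<^sub>w\<close> with \<open>v = u + e\<^sub>i\<close>
  (\<open>x_matrix_unit\<close>, \<open>shift_matrix_unit\<close>), so modulo the relations the span of the \<open>E\<^sub>u\<^sub>w\<close> is
  a left ideal. It contains \<open>1\<close> (\<open>reduces_one\<close>), hence is everything. The coefficients of
  such a combination are the matrix entries of the operator that it represents, so an element
  acting as zero is congruent to zero (\<open>kernel_bw_rep\<close>).
\<close>

section \<open>Operators on regular functions over the two-element field\<close>

text \<open>
  The default rules rewrite arithmetic on bits into Boolean connectives, which hides the ring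
  structure of the sums and products below.
\<close>

declare add_bit_eq_xor [simp del] mult_bit_eq_and [simp del] power_bit_unfold [simp del]

instance bit :: finite
proof
  have "(UNIV :: bit set) = {0, 1}" by (auto intro: bit.exhaust)
  then show "finite (UNIV :: bit set)" by (metis finite.emptyI finite.insertI)
qed

lemma bit_add_self [simp]: "b + b = (0 :: bit)"
  by (cases b) simp_all

lemma bit_add_self_left [simp]: "a + (a + b) = (b :: bit)"
  by (simp flip: add.assoc)

lemma bit_mult_self [simp]: "a * a = (a :: bit)"
  by (cases a) simp_all

lemma bit_vec_add_self [simp]: "u + u = (0 :: bit ^ 'n::finite)"
  by (simp add: vec_eq_iff)

lemma bit_vec_add_self_left [simp]: "u + (u + w) = (w :: bit ^ 'n::finite)"
  by (simp flip: add.assoc)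

definition point_function :: "bit ^ 'n::finite \<Rightarrow> bit ^ 'n \<Rightarrow> bit"
  where "point_function w = (\<lambda>x. of_bool (x = w))"

lemma point_function_eq_prod: "point_function w x = (\<Prod>i\<in>UNIV. x $ i + (w $ i + 1))"
proof (cases "x = w")
  case True
  then have "x $ i + (w $ i + 1) = 1" for i by (simp flip: add.assoc)
  then show ?thesis using True by (simp add: point_function_def)
next
  case False
  then obtain i where i: "x $ i \<noteq> w $ i" by (auto simp: vec_eq_iff)
  have "x $ i + (w $ i + 1) = 0" using i by (cases "x $ i"; cases "w $ i") auto
  then have "(\<Prod>i\<in>UNIV. x $ i + (w $ i + 1)) = 0" by (intro prod_zero) auto
  then show ?thesis using False by (simp add: point_function_def)
qed

text \<open>
  Together with \<open>point_function_eq_prod\<close>, this writes every function as a polynomial in the coordinates.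
\<close>

lemma eq_sum_point_functions:
  fixes f :: "bit ^ 'n::finite \<Rightarrow> bit"
  shows "f = (\<lambda>x. \<Sum>w\<in>UNIV. f w * point_function w x)"
  by (auto simp: point_function_def of_bool_def if_distrib[of "\<lambda>b. _ * b"] sum.delta fun_eq_iff cong: if_cong)

lemma carrier_regular_bit:
  "carrier (regular_functions :: (bit, bit ^ 'n::finite \<Rightarrow> bit) module) = UNIV"
proof -
  have "f \<in> carrier regular_functions" for f :: "bit ^ 'n \<Rightarrow> bit"
    by (subst eq_sum_point_functions, unfold point_function_eq_prod)
       (intro regular_sum regular_mult regular_prod regular_add regular_const regular_coord; simp)
  then show ?thesis by auto
qed

text \<open>
  Over the field with two elements additivity already implies linearity, so this single
  condition describes all endomorphisms.
\<close>

definition additive_op :: "(('a \<Rightarrow> bit) \<Rightarrow> 'a \<Rightarrow> bit) \<Rightarrow> bool"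
  where "additive_op T \<longleftrightarrow> (\<forall>f g. T (\<lambda>x. f x + g x) = (\<lambda>x. T f x + T g x))"

lemma additive_op_add: "additive_op T \<Longrightarrow> T (\<lambda>x. f x + g x) = (\<lambda>x. T f x + T g x)"
  by (simp add: additive_op_def)

lemma additive_op_zero: "additive_op T \<Longrightarrow> T (\<lambda>x. 0) = (\<lambda>x. 0)"
  using additive_op_add[of T "\<lambda>x. 0" "\<lambda>x. 0"] by simp

lemma additive_op_smult:
  assumes "additive_op T"
  shows "T (\<lambda>x. c * f x) = (\<lambda>x. c * T f x)"
  by (cases c) (simp_all add: additive_op_zero[OF assms])

lemma additive_op_sum:
  assumes "additive_op T" "finite A"
  shows "T (\<lambda>x. \<Sum>a\<in>A. f a x) = (\<lambda>x. \<Sum>a\<in>A. T (f a) x)"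
  using assms(2)
  by (induction A rule: finite_induct)
     (simp_all add: additive_op_zero[OF assms(1)] additive_op_add[OF assms(1)])

text \<open>
  The matrix of an endomorphism: its entry at \<open>(x, w)\<close> is the value at \<open>x\<close> of the image of the
  indicator of \<open>w\<close>.
\<close>

lemma additive_op_expand:
  fixes T :: "(bit ^ 'n::finite \<Rightarrow> bit) \<Rightarrow> bit ^ 'n \<Rightarrow> bit"
  assumes "additive_op T"
  shows "T f x = (\<Sum>w\<in>UNIV. f w * T (point_function w) x)"
  by (subst eq_sum_point_functions[of f])
     (simp add: additive_op_sum[OF assms] additive_op_smult[OF assms])

lemma End_regular_ops:
  "carrier (End_regular :: (bit, (bit ^ 'n::finite \<Rightarrow> bit) \<Rightarrow> bit ^ 'n \<Rightarrow> bit) module)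
    = {T. additive_op T}"
  "S \<otimes>\<^bsub>End_regular :: (bit, (bit ^ 'n::finite \<Rightarrow> bit) \<Rightarrow> bit ^ 'n \<Rightarrow> bit) module\<^esub> T = (\<lambda>f. S (T f))"
  "\<one>\<^bsub>End_regular :: (bit, (bit ^ 'n::finite \<Rightarrow> bit) \<Rightarrow> bit ^ 'n \<Rightarrow> bit) module\<^esub> = (\<lambda>f. f)"
  "\<zero>\<^bsub>End_regular :: (bit, (bit ^ 'n::finite \<Rightarrow> bit) \<Rightarrow> bit ^ 'n \<Rightarrow> bit) module\<^esub> = (\<lambda>f x. 0)"
  "S \<oplus>\<^bsub>End_regular :: (bit, (bit ^ 'n::finite \<Rightarrow> bit) \<Rightarrow> bit ^ 'n \<Rightarrow> bit) module\<^esub> T = (\<lambda>f x. S f x + T f x)"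
  "c \<odot>\<^bsub>End_regular :: (bit, (bit ^ 'n::finite \<Rightarrow> bit) \<Rightarrow> bit ^ 'n \<Rightarrow> bit) module\<^esub> T = (\<lambda>f x. c * T f x)"
  by (auto simp: End_algebra_def carrier_regular_bit regular_ops compose_def restrict_def
      additive_op_add additive_op_smult) (simp add: additive_op_def)

lemma mult_coord_apply: "mult_coord i f x = x $ i * f x"
  by (simp add: mult_coord_def carrier_regular_bit)

lemma boolean_deriv_apply: "boolean_deriv i f x = f (x + axis i 1) + f x"
  by (simp add: boolean_deriv_def carrier_regular_bit)

lemma free_algebra_ops:
  "carrier free_algebra = UNIV" "monoid.mult free_algebra = (*)" "one free_algebra = 1"
  "zero free_algebra = 0" "add free_algebra = (+)"
  "c \<odot>\<^bsub>free_algebra\<^esub> p = Poly_Mapping.single 0 c * p"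
  by (simp_all add: free_algebra_def)

section \<open>The representation of the free algebra\<close>

primrec letter_op :: "'n::finite bw_letter \<Rightarrow> (bit ^ 'n \<Rightarrow> bit) \<Rightarrow> bit ^ 'n \<Rightarrow> bit"
  where "letter_op (XL i) = mult_coord i" | "letter_op (YL i) = boolean_deriv i"

definition word_op :: "'n::finite bw_letter free_word \<Rightarrow> (bit ^ 'n \<Rightarrow> bit) \<Rightarrow> bit ^ 'n \<Rightarrow> bit"
  where "word_op w = foldr letter_op (letters w)"

definition bw_rep :: "'n::finite bw_free \<Rightarrow> (bit ^ 'n \<Rightarrow> bit) \<Rightarrow> bit ^ 'n \<Rightarrow> bit"
  where "bw_rep p f x =
    (\<Sum>w\<in>Poly_Mapping.keys p. Poly_Mapping.lookup p w * word_op w f x)"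

lemma additive_letter_op: "additive_op (letter_op a)"
  by (cases a)
     (simp_all add: additive_op_def fun_eq_iff mult_coord_apply boolean_deriv_apply algebra_simps)

lemma additive_word_op: "additive_op (word_op w)"
proof -
  have "additive_op (foldr letter_op l)" for l :: "'a bw_letter list"
    by (induction l)
       (simp_all add: additive_op_def additive_op_add[OF additive_letter_op])
  then show ?thesis by (simp add: word_op_def)
qed

lemma word_op_plus: "word_op (v + w) f = word_op v (word_op w f)"
  by (simp add: word_op_def plus_free_word_def)

lemma bw_rep_superset:
  assumes "finite F" "Poly_Mapping.keys p \<subseteq> F"
  shows "bw_rep p f x = (\<Sum>w\<in>F. Poly_Mapping.lookup p w * word_op w f x)"
  unfolding bw_rep_def by (rule sum.mono_neutral_left) (use assms in \<open>auto simp: in_keys_iff\<close>)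

lemma bw_rep_add: "bw_rep (p + q) f x = bw_rep p f x + bw_rep q f x"
proof -
  let ?F = "Poly_Mapping.keys p \<union> Poly_Mapping.keys q"
  have "Poly_Mapping.keys (p + q) \<subseteq> ?F" by (rule Poly_Mapping.keys_add)
  then show ?thesis
    by (simp add: bw_rep_superset[of ?F] lookup_add algebra_simps sum.distrib)
qed

lemma bw_rep_zero [simp]: "bw_rep 0 f x = 0"
  by (simp add: bw_rep_def)

lemma bw_rep_sum: "finite A \<Longrightarrow> bw_rep (\<Sum>a\<in>A. p a) f x = (\<Sum>a\<in>A. bw_rep (p a) f x)"
  by (induction A rule: finite_induct) (simp_all add: bw_rep_add)

lemma bw_rep_single: "bw_rep (Poly_Mapping.single w c) f x = c * word_op w f x"
  by (simp add: bw_rep_superset[of "{w}"])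

text \<open>
  The only nonzero coefficient is \<open>1\<close>, so the words generate the free algebra as an abelian
  group.
\<close>

lemma bw_free_induct [case_names zero add]:
  fixes p :: "'a free_word \<Rightarrow>\<^sub>0 bit"
  assumes "P 0" "\<And>p w. P p \<Longrightarrow> P (p + Poly_Mapping.single w 1)"
  shows "P p"
proof (induction p rule: update_induct)
  case const
  show ?case by (rule assms(1))
next
  case (update p w c)
  then have "c = 1" by simp
  with update have "Poly_Mapping.update w c p = p + Poly_Mapping.single w 1"
    by (intro poly_mapping_eqI)
       (auto simp: lookup_update lookup_add lookup_single when_def in_keys_iff)
  then show ?case using update assms(2) by simp
qed

lemma single_Word_Cons:
  "Poly_Mapping.single (Word (a # l)) 1 = free_gen a * Poly_Mapping.single (Word l) 1"
  by (simp add: free_gen_def mult_single plus_free_word_def)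

lemma single_Word_Nil: "Poly_Mapping.single (Word []) 1 = 1"
  by (simp flip: zero_free_word_def)

lemma additive_bw_rep: "additive_op (bw_rep p)"
  by (simp add: additive_op_def fun_eq_iff bw_rep_def additive_op_add[OF additive_word_op] distrib_left
      sum.distrib)

lemma bw_rep_mult: "bw_rep (p * q) f = bw_rep p (bw_rep q f)"
proof (induction p rule: bw_free_induct)
  case zero
  then show ?case by (simp add: fun_eq_iff)
next
  case (add p v)
  have "bw_rep (Poly_Mapping.single v 1 * q) f = word_op v (bw_rep q f)"
  proof (induction q rule: bw_free_induct)
    case zero
    then show ?case
      using additive_op_zero[OF additive_word_op, of v] by (simp add: fun_eq_iff)
  next
    case (add q w)
    have "bw_rep (q + Poly_Mapping.single w 1) f = (\<lambda>x. bw_rep q f x + word_op w f x)"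
      by (simp add: fun_eq_iff bw_rep_add bw_rep_single)
    with add show ?case
      by (simp add: fun_eq_iff distrib_left bw_rep_add mult_single bw_rep_single word_op_plus
          additive_op_add[OF additive_word_op])
  qed
  with add show ?case
    by (simp add: fun_eq_iff distrib_right bw_rep_add bw_rep_single)
qed

lemma bw_rep_one [simp]: "bw_rep 1 f = f"
  by (simp add: fun_eq_iff bw_rep_single word_op_def flip: single_Word_Nil)

lemma bw_rep_const: "bw_rep (Poly_Mapping.single 0 c) f x = c * f x"
  by (simp add: bw_rep_single word_op_def zero_free_word_def)

lemma bw_rep_const_mult: "bw_rep (Poly_Mapping.single 0 c * p) f x = c * bw_rep p f x"
  by (simp add: bw_rep_mult bw_rep_const)

lemma bw_rep_x: "bw_rep (bw_x i) f x = x $ i * f x"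
  by (simp add: free_gen_def bw_rep_single word_op_def mult_coord_apply)

lemma bw_rep_y: "bw_rep (bw_y i) f x = f (x + axis i 1) + f x"
  by (simp add: free_gen_def bw_rep_single word_op_def boolean_deriv_apply)

lemma bw_action_bw_rep: "bw_action bw_rep"
  unfolding bw_action_def algebra_hom_def
  by (auto simp: ring_hom_def End_regular_ops free_algebra_ops additive_bw_rep bw_rep_mult
      bw_rep_add bw_rep_const bw_rep_x bw_rep_y mult_coord_apply boolean_deriv_apply fun_eq_iff)

text \<open>
  A homomorphism is determined on words by its values on the generators, and words span.
\<close>

lemma bw_action_unique:
  assumes "bw_action \<Phi>"
  shows "\<Phi> = bw_rep"
proof
  fix p
  have hom: "\<Phi> (p * q) = (\<lambda>f. \<Phi> p (\<Phi> q f))" "\<Phi> (p + q) = (\<lambda>f x. \<Phi> p f x + \<Phi> q f x)"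
    "\<Phi> 1 = (\<lambda>f. f)" for p q
    using assms
    by (auto simp: bw_action_def algebra_hom_def ring_hom_def End_regular_ops free_algebra_ops)
  have gen: "\<Phi> (free_gen a) = letter_op a" for a
    using assms by (cases a) (simp_all add: bw_action_def)
  have word: "\<Phi> (Poly_Mapping.single (Word l) 1) = foldr letter_op l" for l
    by (induction l) (simp_all add: single_Word_Nil single_Word_Cons hom gen comp_def id_def)
  show "\<Phi> p = bw_rep p"
  proof (induction p rule: bw_free_induct)
    case zero
    have "\<Phi> 0 = (\<lambda>f x. 0)" using hom(2)[of 0 0] by simp
    then show ?case by (simp add: fun_eq_iff)
  next
    case (add p w)
    then show ?case
      by (cases w) (simp add: hom word fun_eq_iff bw_rep_add bw_rep_single word_op_def)
  qed
qed

lemma ring_hom_ring_bw_rep: "ring_hom_ring free_algebra End_regular bw_rep"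
proof -
  have "ring (free_algebra :: (bit, 'a bw_free) module)"
    using free_algebra_assoc_algebra by (rule assoc_algebra.axioms)
  moreover have "ring (End_regular :: (bit, (bit ^ 'a \<Rightarrow> bit) \<Rightarrow> bit ^ 'a \<Rightarrow> bit) module)"
    by (rule assoc_algebra.axioms[OF End_assoc_algebra])
       (rule assoc_algebra.axioms[OF regular_functions_assoc_algebra])
  ultimately show ?thesis
    using bw_action_bw_rep
    by (auto simp: bw_action_def algebra_hom_def intro: ring_hom_ringI2)
qed

lemma free_self_add [simp]: "p + p = (0 :: 'a free_word \<Rightarrow>\<^sub>0 bit)"
  by (rule poly_mapping_eqI) (simp add: lookup_add)

text \<open>
  The kernel is an ideal, so only the defining relations are to be tested. For
  \<open>y\<^sub>i x\<^sub>i + x\<^sub>i y\<^sub>i + y\<^sub>i + 1\<close> this is the twisted Leibniz rule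
  \<open>\<partial>\<^sub>i(x\<^sub>i f) = x\<^sub>i \<partial>\<^sub>i f + \<partial>\<^sub>i f + f\<close>.
\<close>

lemma bw_ideal_subset_kernel: "bw_ideal \<subseteq> a_kernel free_algebra End_regular bw_rep"
proof -
  interpret h: ring_hom_ring free_algebra End_regular bw_rep by (rule ring_hom_ring_bw_rep)
  have "bw_relations \<subseteq> a_kernel free_algebra End_regular bw_rep"
    unfolding a_kernel_def'
    by (auto simp: bw_relations_def free_algebra_ops End_regular_ops fun_eq_iff power2_eq_square
        bw_rep_add bw_rep_mult bw_rep_x bw_rep_y axis_def distrib_left distrib_right add_ac mult_ac)
  then show ?thesis
    unfolding bw_ideal_def by (intro h.R.genideal_minimal h.kernel_is_ideal)
qed


section \<open>Congruence modulo the Boole-Weyl relations\<close>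

lemma free_add_self_left [simp]: "p + (p + q) = (q :: 'a free_word \<Rightarrow>\<^sub>0 bit)"
  by (simp flip: add.assoc)

text \<open>
  Calculations in the Boole-Weyl algebra are carried out on representatives. Signs do not matter
  in characteristic two, so the sum takes the place of the difference.
\<close>

definition bw_cong :: "'n bw_free \<Rightarrow> 'n bw_free \<Rightarrow> bool" (infix "\<sim>" 50)
  where "p \<sim> q \<longleftrightarrow> p + q \<in> bw_ideal"

lemma bw_ideal_closed:
  fixes p q r :: "'n bw_free"
  shows "(0 :: 'n bw_free) \<in> bw_ideal"
  and "p \<in> bw_ideal \<Longrightarrow> q \<in> bw_ideal \<Longrightarrow> p + q \<in> bw_ideal"
  and "p \<in> bw_ideal \<Longrightarrow> r * p \<in> bw_ideal"
  and "p \<in> bw_ideal \<Longrightarrow> p * r \<in> bw_ideal"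
proof -
  interpret I: ideal bw_ideal "free_algebra :: (bit, 'n bw_free) module" by (rule ideal_bw_ideal)
  show "(0 :: 'n bw_free) \<in> bw_ideal" using additive_subgroup.zero_closed[OF I.is_additive_subgroup] by (simp add: free_algebra_ops)
  show "p \<in> bw_ideal \<Longrightarrow> q \<in> bw_ideal \<Longrightarrow> p + q \<in> bw_ideal"
    using additive_subgroup.a_closed[OF I.is_additive_subgroup, of p q] by (simp add: free_algebra_ops)
  show "p \<in> bw_ideal \<Longrightarrow> r * p \<in> bw_ideal"
    using I.I_l_closed[of p r] by (simp add: free_algebra_ops)
  show "p \<in> bw_ideal \<Longrightarrow> p * r \<in> bw_ideal"
    using I.I_r_closed[of p r] by (simp add: free_algebra_ops)
qed

lemma bw_cong_refl [simp]: "p \<sim> p"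
  by (simp add: bw_cong_def bw_ideal_closed)

lemma bw_cong_trans [trans]:
  assumes "p \<sim> q" "q \<sim> r"
  shows "p \<sim> r"
proof -
  have "(p + q) + (q + r) \<in> bw_ideal"
    by (rule bw_ideal_closed(2)) (use assms in \<open>simp_all add: bw_cong_def\<close>)
  then show ?thesis by (simp add: bw_cong_def add.assoc)
qed

lemma bw_cong_add:
  assumes "p \<sim> p'" "q \<sim> q'"
  shows "p + q \<sim> p' + q'"
proof -
  have "(p + p') + (q + q') \<in> bw_ideal"
    by (rule bw_ideal_closed(2)) (use assms in \<open>simp_all add: bw_cong_def\<close>)
  then show ?thesis by (simp add: bw_cong_def add_ac)
qed

lemma bw_cong_mult:
  assumes "p \<sim> p'" "q \<sim> q'"
  shows "p * q \<sim> p' * q'"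
proof -
  have "p * q + p' * q' = (p + p') * q + p' * (q + q')"
    by (simp add: distrib_left distrib_right add_ac)
  then show ?thesis using assms by (simp add: bw_cong_def bw_ideal_closed)
qed

lemma bw_cong_relation: "p + q \<in> bw_relations \<Longrightarrow> p \<sim> q"
proof -
  interpret ring "free_algebra :: (bit, 'a bw_free) module"
    using free_algebra_assoc_algebra by (rule assoc_algebra.axioms)
  have "bw_relations \<subseteq> (bw_ideal :: 'a bw_free set)"
    unfolding bw_ideal_def by (rule genideal_self) (simp add: free_algebra_ops)
  then show "p + q \<in> bw_relations \<Longrightarrow> p \<sim> q" by (auto simp: bw_cong_def)
qed

text \<open>
  Operators may be computed on any representative.
\<close>

lemma bw_cong_imp_rep_eq: "p \<sim> q \<Longrightarrow> bw_rep p = bw_rep q"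
proof -
  assume "p \<sim> q"
  then have "p + q \<in> a_kernel free_algebra End_regular bw_rep"
    using bw_ideal_subset_kernel by (auto simp: bw_cong_def)
  then have "bw_rep p f x + bw_rep q f x = 0" for f x
    by (simp add: a_kernel_def' End_regular_ops fun_eq_iff bw_rep_add)
  then show ?thesis
    by (intro ext) (metis add_eq_0_iff bit_add_self minus_unique)
qed

abbreviation bw_const :: "bit \<Rightarrow> 'n bw_free"
  where "bw_const \<equiv> Poly_Mapping.single 0"

lemma bw_const_central: "p * bw_const c = bw_const c * p"
  by (cases c) simp_all

abbreviation bw_shift :: "'n \<Rightarrow> 'n bw_free"
  where "bw_shift i \<equiv> bw_y i + 1"

lemma x_commute_factor: "bw_x i * (bw_x j + bw_const c) \<sim> (bw_x j + bw_const c) * bw_x i"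
proof -
  have "bw_x i * bw_x j \<sim> bw_x j * bw_x i"
    by (rule bw_cong_relation) (auto simp: bw_relations_def)
  then show ?thesis
    by (simp add: distrib_left distrib_right bw_const_central bw_cong_add)
qed

text \<open>
  The factor \<open>x\<^sub>i + c + 1\<close> vanishes unless \<open>x\<^sub>i = c\<close>, so by idempotency \<open>x\<^sub>i\<close> may be replaced by
  \<open>c\<close> in front of it.
\<close>

lemma x_eigen_factor: "bw_x i * (bw_x i + bw_const (c + 1)) \<sim> bw_const c * (bw_x i + bw_const (c + 1))"
proof -
  have "bw_x i * bw_x i \<sim> bw_x i"
    by (rule bw_cong_relation) (auto simp: bw_relations_def power2_eq_square)
  then show ?thesis
    by (cases c) (simp_all add: bw_cong_def distrib_left)
qed

text \<open>
  Moving \<open>s\<^sub>i\<close> past a coordinate substitutes \<open>x\<^sub>i + 1\<close> for \<open>x\<^sub>i\<close>. The unit vector in the constant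
  treats the cases \<open>i = j\<close> and \<open>i \<noteq> j\<close> alike.
\<close>

lemma shift_commute_factor:
  "bw_shift i * (bw_x j + bw_const c) \<sim> (bw_x j + bw_const (c + axis i 1 $ j)) * bw_shift i"
proof (cases "i = j")
  case True
  have "bw_y i * bw_x i \<sim> bw_x i * bw_y i + bw_y i + 1"
    by (rule bw_cong_relation) (auto simp: bw_relations_def add.assoc)
  then show ?thesis using True
    by (cases c) (simp_all add: bw_cong_def axis_def distrib_left distrib_right add_ac)
next
  case False
  then have "bw_y i * bw_x j \<sim> bw_x j * bw_y i"
    by (intro bw_cong_relation) (auto simp: bw_relations_def)
  then show ?thesis using False
    by (cases c) (simp_all add: bw_cong_def axis_def distrib_left distrib_right add_ac)
qed

lemma shift_involution: "bw_shift i * bw_shift i \<sim> 1"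
proof -
  have "bw_y i * bw_y i \<sim> 0"
    by (rule bw_cong_relation) (auto simp: bw_relations_def power2_eq_square)
  then show ?thesis by (simp add: bw_cong_def distrib_left distrib_right add_ac)
qed

lemma shift_commute: "bw_shift i * bw_shift j \<sim> bw_shift j * bw_shift i"
proof -
  have "bw_y i * bw_y j \<sim> bw_y j * bw_y i"
    by (rule bw_cong_relation) (auto simp: bw_relations_def)
  then show ?thesis by (simp add: bw_cong_def distrib_left distrib_right add_ac)
qed

section \<open>Matrix units\<close>

text \<open>
  Products over an explicit list of coordinates, since the factors do not commute in the free
  algebra. On a list of all coordinates this represents multiplication by the indicator of \<open>u\<close>.
\<close>

primrec point_poly :: "'n::finite list \<Rightarrow> bit ^ 'n \<Rightarrow> 'n bw_free"
  where "point_poly [] u = 1"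
  | "point_poly (j # js) u = (bw_x j + bw_const (u $ j + 1)) * point_poly js u"

primrec translation :: "'n::finite list \<Rightarrow> bit ^ 'n \<Rightarrow> 'n bw_free"
  where "translation [] v = 1"
  | "translation (j # js) v = (if v $ j = 1 then bw_shift j else 1) * translation js v"

text \<open>
  Commute \<open>x\<^sub>i\<close> to the factor that carries the index \<open>i\<close>; there it becomes the scalar \<open>u\<^sub>i\<close>.
\<close>

lemma x_eigen_point_poly:
  "i \<in> set js \<Longrightarrow> bw_x i * point_poly js u \<sim> bw_const (u $ i) * point_poly js u"
proof (induction js)
  case (Cons j js)
  let ?F = "bw_x j + bw_const (u $ j + 1)"
  show ?case
  proof (cases "i = j")
    case True
    then show ?thesis
      using bw_cong_mult[OF x_eigen_factor[of j "u $ j"] bw_cong_refl[of "point_poly js u"]]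
      by (simp add: mult.assoc)
  next
    case False
    have "bw_x i * point_poly (j # js) u = (bw_x i * ?F) * point_poly js u"
      by (simp add: mult.assoc)
    also have "\<dots> \<sim> (?F * bw_x i) * point_poly js u"
      by (intro bw_cong_mult x_commute_factor bw_cong_refl)
    also have "\<dots> = ?F * (bw_x i * point_poly js u)" by (simp add: mult.assoc)
    also have "\<dots> \<sim> ?F * (bw_const (u $ i) * point_poly js u)"
      by (rule bw_cong_mult[OF bw_cong_refl]) (use Cons False in simp)
    also have "\<dots> = bw_const (u $ i) * point_poly (j # js) u"
      by (simp add: bw_const_central flip: mult.assoc)
    finally show ?thesis .
  qed
qed simp

lemma shift_point_poly:
  "bw_shift i * point_poly js u \<sim> point_poly js (u + axis i 1) * bw_shift i"
proof (induction js)
  case (Cons j js)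
  let ?c = "u $ j + 1"
  have "bw_shift i * point_poly (j # js) u
      = (bw_shift i * (bw_x j + bw_const ?c)) * point_poly js u"
    by (simp add: mult.assoc)
  also have "\<dots> \<sim> ((bw_x j + bw_const (?c + axis i 1 $ j)) * bw_shift i) * point_poly js u"
    by (intro bw_cong_mult shift_commute_factor bw_cong_refl)
  also have "\<dots> = (bw_x j + bw_const (?c + axis i 1 $ j)) * (bw_shift i * point_poly js u)"
    by (simp only: mult.assoc)
  also have "\<dots> \<sim> (bw_x j + bw_const (?c + axis i 1 $ j))
      * (point_poly js (u + axis i 1) * bw_shift i)"
    by (intro bw_cong_mult Cons.IH bw_cong_refl)
  also have "\<dots> = point_poly (j # js) (u + axis i 1) * bw_shift i"
    by (simp only: point_poly.simps mult.assoc vector_add_component add_ac)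
  finally show ?case .
qed simp

lemma point_poly_cong:
  "(\<And>j. j \<in> set js \<Longrightarrow> u $ j = v $ j) \<Longrightarrow> point_poly js u = point_poly js v"
  by (induction js) simp_all

lemma translation_cong:
  "(\<And>j. j \<in> set js \<Longrightarrow> u $ j = v $ j) \<Longrightarrow> translation js u = translation js v"
  by (induction js) simp_all

lemma translation_zero: "translation js 0 = 1"
  by (induction js) simp_all

text \<open>
  Commute \<open>s\<^sub>i\<close> to its place in the product, where it either appears for the first time or cancels
  a second copy of itself. This needs \<open>i\<close> to have exactly one place, whence distinctness.
\<close>

lemma shift_translation:
  "distinct js \<Longrightarrow> i \<in> set js \<Longrightarrow> bw_shift i * translation js v \<sim> translation js (v + axis i 1)"
proof (induction js)
  case (Cons j js)
  let ?F = "if v $ j = 1 then bw_shift j else 1"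
  show ?case
  proof (cases "i = j")
    case True
    have same: "translation js (v + axis i 1) = translation js v"
      using Cons.prems True by (intro translation_cong) (auto simp: axis_def)
    show ?thesis
    proof (cases "v $ j = 0")
      case zero: True
      then show ?thesis using True same by (simp add: axis_def)
    next
      case False
      then have one: "v $ j = 1" by simp
      have "bw_shift j * (bw_shift j * translation js v) \<sim> 1 * translation js v"
        unfolding mult.assoc[symmetric] by (intro bw_cong_mult shift_involution bw_cong_refl)
      then show ?thesis using True same one by (simp add: axis_def)
    qed
  next
    case False
    have "bw_shift i * translation (j # js) v = (bw_shift i * ?F) * translation js v"
      by (simp add: mult.assoc)
    also have "\<dots> \<sim> (?F * bw_shift i) * translation js v"
      by (rule bw_cong_mult[OF _ bw_cong_refl]) (simp add: shift_commute)
    also have "\<dots> = ?F * (bw_shift i * translation js v)" by (simp only: mult.assoc)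
    also have "\<dots> \<sim> ?F * translation js (v + axis i 1)"
      using Cons False by (intro bw_cong_mult bw_cong_refl) simp
    also have "\<dots> = translation (j # js) (v + axis i 1)"
      using False by (simp add: axis_def)
    finally show ?thesis .
  qed
qed simp

definition coord_list :: "'n::finite list"
  where "coord_list = (SOME js. distinct js \<and> set js = UNIV)"

lemma coord_list:
  "distinct (coord_list :: 'n::finite list)" "set (coord_list :: 'n::finite list) = UNIV"
proof -
  have "\<exists>js :: 'n list. distinct js \<and> set js = UNIV"
    using finite_distinct_list[of "UNIV :: 'n set"] by auto
  from someI_ex[OF this]
  show "distinct (coord_list :: 'n list)" "set (coord_list :: 'n list) = UNIV"
    by (auto simp: coord_list_def)
qed

text \<open>
  The product sends \<open>f\<close> to the function with value \<open>f (u + (u + w)) = f w\<close> at \<open>u\<close> and zero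
  elsewhere.
\<close>

definition matrix_unit :: "bit ^ 'n \<Rightarrow> bit ^ 'n \<Rightarrow> 'n::finite bw_free"
  where "matrix_unit u w = point_poly coord_list u * translation coord_list (u + w)"

lemma bw_rep_point_poly:
  "bw_rep (point_poly js u) f x = (if \<forall>j\<in>set js. x $ j = u $ j then f x else 0)"
proof (induction js)
  case (Cons j js)
  then show ?case
    by (cases "x $ j"; cases "u $ j")
       (simp_all add: bw_rep_mult bw_rep_add bw_rep_x bw_rep_const)
qed simp

lemma bw_rep_shift: "bw_rep (bw_shift i) f x = f (x + axis i 1)"
  by (simp add: bw_rep_add bw_rep_y add.assoc)

lemma bw_rep_translation:
  fixes v :: "bit ^ 'n::finite"
  shows "distinct js \<Longrightarrow>
    bw_rep (translation js v) f x = f (x + (\<chi> j. if j \<in> set js then v $ j else 0))"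
proof (induction js arbitrary: x)
  case Nil
  have "(\<chi> j. 0) = (0 :: bit ^ 'n)" by (simp add: vec_eq_iff)
  then show ?case by simp
next
  case (Cons j js)
  let ?t = "\<lambda>js. \<chi> j. if j \<in> set js then v $ j else 0"
  have IH: "bw_rep (translation js v) f y = f (y + ?t js)" for y using Cons by simp
  show ?case
  proof (cases "v $ j = 0")
    case zero: True
    then have "?t (j # js) = ?t js" by (simp add: vec_eq_iff)
    with zero IH show ?thesis by simp
  next
    case False
    then have one: "v $ j = 1" by simp
    then have "?t (j # js) = axis j 1 + ?t js"
      using Cons.prems by (auto simp: vec_eq_iff axis_def)
    with one IH show ?thesis by (simp only: translation.simps bw_rep_mult bw_rep_shift add.assoc if_True simp_thms)
  qed
qed

lemma bw_rep_matrix_unit: "bw_rep (matrix_unit u w) f x = (if x = u then f w else 0)"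
proof -
  have "bw_rep (translation coord_list (u + w)) f y = f (y + (u + w))" for y
    by (simp only: bw_rep_translation coord_list UNIV_I if_True vec_nth_inverse)
  moreover have "(\<forall>j\<in>set coord_list. x $ j = u $ j) \<longleftrightarrow> x = u"
    by (simp add: coord_list vec_eq_iff)
  ultimately show ?thesis by (simp add: matrix_unit_def bw_rep_mult bw_rep_point_poly)
qed

lemma x_matrix_unit: "bw_x i * matrix_unit u w \<sim> bw_const (u $ i) * matrix_unit u w"
  unfolding matrix_unit_def mult.assoc[symmetric]
  by (intro bw_cong_mult x_eigen_point_poly bw_cong_refl) (simp add: coord_list)

lemma shift_matrix_unit: "bw_shift i * matrix_unit u w \<sim> matrix_unit (u + axis i 1) w"
proof -
  let ?p = "point_poly coord_list" and ?t = "translation coord_list"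
  have "bw_shift i * matrix_unit u w = (bw_shift i * ?p u) * ?t (u + w)"
    by (simp add: matrix_unit_def mult.assoc)
  also have "\<dots> \<sim> (?p (u + axis i 1) * bw_shift i) * ?t (u + w)"
    by (intro bw_cong_mult shift_point_poly bw_cong_refl)
  also have "\<dots> = ?p (u + axis i 1) * (bw_shift i * ?t (u + w))" by (simp only: mult.assoc)
  also have "\<dots> \<sim> ?p (u + axis i 1) * ?t (u + w + axis i 1)"
    by (intro bw_cong_mult shift_translation bw_cong_refl) (simp_all add: coord_list)
  also have "\<dots> = matrix_unit (u + axis i 1) w"
    by (simp add: matrix_unit_def add_ac)
  finally show ?thesis .
qed

section \<open>Every element is a combination of matrix units\<close>

text \<open>
  The element with the same matrix as \<open>T\<close>, a linear section of the representation.
\<close>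

definition matrix_form :: "((bit ^ 'n \<Rightarrow> bit) \<Rightarrow> bit ^ 'n \<Rightarrow> bit) \<Rightarrow> 'n::finite bw_free"
  where "matrix_form T =
    (\<Sum>u\<in>UNIV. \<Sum>w\<in>UNIV. bw_const (T (point_function w) u) * matrix_unit u w)"

lemma bw_rep_matrix_form:
  assumes "additive_op T"
  shows "bw_rep (matrix_form T) = T"
proof (intro ext)
  fix f x
  have "bw_rep (matrix_form T) f x
      = (\<Sum>u\<in>UNIV. if x = u then \<Sum>w\<in>UNIV. T (point_function w) u * f w else 0)"
    unfolding matrix_form_def bw_rep_sum[OF finite] bw_rep_const_mult bw_rep_matrix_unit
    by (rule sum.cong) simp_all
  also have "\<dots> = (\<Sum>w\<in>UNIV. f w * T (point_function w) x)"
    by (simp add: mult.commute)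
  also have "\<dots> = T f x" by (rule additive_op_expand[OF assms, symmetric])
  finally show "bw_rep (matrix_form T) f x = T f x" .
qed

text \<open>
  Membership in the span of the matrix units modulo the relations. The operator of \<open>p\<close> leaves
  only one candidate for the coefficients, so no choice of them has to be made.
\<close>

definition reduces :: "'n::finite bw_free \<Rightarrow> bool"
  where "reduces p \<longleftrightarrow> p \<sim> matrix_form (bw_rep p)"

lemma matrix_form_zero: "matrix_form (bw_rep 0) = 0"
  by (simp add: matrix_form_def)

lemma reduces_zero: "reduces 0"
  by (simp add: reduces_def matrix_form_zero)

lemma reduces_add: "reduces p \<Longrightarrow> reduces q \<Longrightarrow> reduces (p + q)"
proof -
  have "matrix_form (bw_rep (p + q)) = matrix_form (bw_rep p) + matrix_form (bw_rep q)"
    by (simp add: matrix_form_def bw_rep_add single_add distrib_right sum.distrib)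
  then show "reduces p \<Longrightarrow> reduces q \<Longrightarrow> reduces (p + q)"
    by (simp add: reduces_def bw_cong_add)
qed

lemma reduces_const_mult: "reduces p \<Longrightarrow> reduces (bw_const c * p)"
  by (cases c) (simp_all add: reduces_zero)

lemma reduces_sum: "(\<And>a. a \<in> A \<Longrightarrow> reduces (p a)) \<Longrightarrow> reduces (\<Sum>a\<in>A. p a)"
  by (induction A rule: infinite_finite_induct) (simp_all add: reduces_zero reduces_add)

lemma reduces_cong: "p \<sim> q \<Longrightarrow> reduces q \<Longrightarrow> reduces p"
  unfolding reduces_def by (metis bw_cong_imp_rep_eq bw_cong_trans)

lemma reduces_matrix_unit: "reduces (matrix_unit u w)"
proof -
  have "matrix_form (bw_rep (matrix_unit u w))
      = (\<Sum>u'\<in>UNIV. \<Sum>w'\<in>UNIV. if u' = u \<and> w' = w then matrix_unit u' w' else 0)"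
    unfolding matrix_form_def
    by (intro sum.cong refl) (auto simp: bw_rep_matrix_unit point_function_def)
  also have "\<dots> = (\<Sum>u'\<in>UNIV. if u' = u then matrix_unit u' w else 0)"
    by (intro sum.cong refl) simp
  also have "\<dots> = matrix_unit u w" by simp
  finally show ?thesis by (simp add: reduces_def)
qed

lemma reduces_gen_matrix_unit: "reduces (free_gen a * matrix_unit u w)"
proof (cases a)
  case (XL i)
  then show ?thesis
    using reduces_cong[OF x_matrix_unit reduces_const_mult[OF reduces_matrix_unit]] by simp
next
  case (YL i)
  have "bw_y i * matrix_unit u w = bw_shift i * matrix_unit u w + matrix_unit u w"
    by (simp add: distrib_right add.assoc)
  moreover have "reduces (bw_shift i * matrix_unit u w)"
    by (rule reduces_cong[OF shift_matrix_unit reduces_matrix_unit])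
  ultimately show ?thesis using YL by (simp add: reduces_add reduces_matrix_unit)
qed

text \<open>
  With \<open>reduces_add\<close>, this makes the span of the matrix units a left ideal modulo the
  relations.
\<close>

lemma reduces_gen_mult:
  assumes "reduces p"
  shows "reduces (free_gen a * p)"
proof (rule reduces_cong)
  show "free_gen a * p \<sim> free_gen a * matrix_form (bw_rep p)"
    using assms by (intro bw_cong_mult bw_cong_refl) (simp add: reduces_def)
  have "free_gen a * matrix_form (bw_rep p) = (\<Sum>u\<in>UNIV. \<Sum>w\<in>UNIV.
      bw_const (bw_rep p (point_function w) u) * (free_gen a * matrix_unit u w))"
    by (simp add: matrix_form_def sum_distrib_left bw_const_central flip: mult.assoc)
  then show "reduces (free_gen a * matrix_form (bw_rep p))"
    by (simp add: reduces_sum reduces_const_mult reduces_gen_matrix_unit)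
qed

text \<open>
  The diagonal matrix units are the products \<open>D\<^sub>u\<close> over all coordinates. A factor is removed from
  such a product by adding the product for the point with that coordinate flipped, because
  \<open>(x\<^sub>j + u\<^sub>j + 1) + (x\<^sub>j + u\<^sub>j) = 1\<close>. Once all factors are gone, \<open>1\<close> remains.
\<close>

lemma reduces_one: "reduces (1 :: 'n::finite bw_free)"
proof -
  have peel: "distinct js \<Longrightarrow> (\<And>u. reduces (point_poly js u)) \<Longrightarrow> reduces (1 :: 'n bw_free)"
    for js :: "'n list"
  proof (induction js)
    case (Cons j js)
    have "reduces (point_poly js u)" for u :: "bit ^ 'n"
    proof -
      let ?P = "point_poly js u"
      have "point_poly js (u + axis j 1) = ?P"
        using Cons.prems by (intro point_poly_cong) (auto simp: axis_def)
      then have "?P = point_poly (j # js) u + point_poly (j # js) (u + axis j 1)"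
        by (cases "u $ j") (simp_all add: axis_def distrib_right add_ac)
      then show ?thesis using Cons.prems(2) reduces_add by metis
    qed
    then show ?case using Cons by simp
  qed simp
  have "point_poly coord_list u = matrix_unit u u" for u :: "bit ^ 'n"
    by (simp add: matrix_unit_def translation_zero)
  then have "reduces (point_poly coord_list u)" for u :: "bit ^ 'n"
    by (simp add: reduces_matrix_unit)
  with coord_list(1) show ?thesis by (rule peel)
qed

lemma reduces_all: "reduces p"
proof (induction p rule: bw_free_induct)
  case zero
  show ?case by (rule reduces_zero)
next
  case (add p w)
  have "reduces (Poly_Mapping.single (Word l) 1)" for l :: "'a bw_letter list"
    by (induction l) (simp_all add: single_Word_Nil single_Word_Cons reduces_one reduces_gen_mult)
  then show ?case using add by (cases w) (simp add: reduces_add)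
qed

lemma kernel_bw_rep: "a_kernel free_algebra End_regular bw_rep = bw_ideal"
proof
  show "a_kernel free_algebra End_regular bw_rep \<subseteq> bw_ideal"
  proof
    fix p assume "p \<in> a_kernel free_algebra End_regular bw_rep"
    then have "bw_rep p = bw_rep 0"
      by (simp add: a_kernel_def' End_regular_ops fun_eq_iff)
    then have "p \<sim> 0" using reduces_all[of p] by (simp add: reduces_def matrix_form_zero)
    then show "p \<in> bw_ideal" by (simp add: bw_cong_def)
  qed
qed (rule bw_ideal_subset_kernel)

theorem theorem11:
  shows "(\<exists>!\<Phi> :: 'n::finite bw_free \<Rightarrow> (bit ^ 'n \<Rightarrow> bit) \<Rightarrow> (bit ^ 'n \<Rightarrow> bit). bw_action \<Phi>) \<and>
    (\<forall>\<Phi> :: 'n bw_free \<Rightarrow> (bit ^ 'n \<Rightarrow> bit) \<Rightarrow> (bit ^ 'n \<Rightarrow> bit). bw_action \<Phi> \<longrightarrow>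
      (\<exists>\<psi> \<in> algebra_iso Z2 boole_weyl End_regular.
        \<forall>p \<in> carrier free_algebra. \<psi> (bw_ideal +>\<^bsub>free_algebra\<^esub> p) = \<Phi> p))"
proof (intro conjI allI impI)
  show "\<exists>!\<Phi> :: 'n bw_free \<Rightarrow> (bit ^ 'n \<Rightarrow> bit) \<Rightarrow> (bit ^ 'n \<Rightarrow> bit). bw_action \<Phi>"
    using bw_action_bw_rep bw_action_unique by blast
next
  fix \<Phi> :: "'n bw_free \<Rightarrow> (bit ^ 'n \<Rightarrow> bit) \<Rightarrow> (bit ^ 'n \<Rightarrow> bit)"
  assume "bw_action \<Phi>"
  then have \<Phi>: "\<Phi> = bw_rep" by (rule bw_action_unique)
  let ?F = "free_algebra :: (bit, 'n bw_free) module"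
  let ?E = "End_regular :: (bit, (bit ^ 'n \<Rightarrow> bit) \<Rightarrow> bit ^ 'n \<Rightarrow> bit) module"
  let ?B = "boole_weyl :: (bit, 'n bw_free set) module"
  interpret h: ring_hom_ring ?F ?E bw_rep by (rule ring_hom_ring_bw_rep)
  define \<psi> where "\<psi> = (\<lambda>X. the_elem ((bw_rep :: 'n bw_free \<Rightarrow> _) ` X))"
  have \<psi>_coset: "\<psi> (bw_ideal +>\<^bsub>?F\<^esub> p) = bw_rep p" for p
    using h.the_elem_simp[of p] by (simp add: \<psi>_def kernel_bw_rep free_algebra_ops)
  have "bw_rep ` carrier ?F = carrier ?E"
    using bw_rep_matrix_form
    by (force simp: End_regular_ops free_algebra_ops additive_bw_rep intro: image_eqI[OF sym])
  then have iso: "\<psi> \<in> ring_iso (?F Quot bw_ideal) ?E"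
    using h.FactRing_iso_set by (simp add: \<psi>_def kernel_bw_rep)
  have "\<psi> (c \<odot>\<^bsub>?B\<^esub> X) = c \<odot>\<^bsub>?E\<^esub> \<psi> X" if X: "X \<in> carrier ?B" for c X
  proof -
    obtain p where p: "X = bw_ideal +>\<^bsub>?F\<^esub> p"
      using X by (auto simp: boole_weyl_def quotient_algebra_def FactRing_simps a_r_coset_def
          free_algebra_def)
    have "c \<odot>\<^bsub>?B\<^esub> X = bw_ideal +>\<^bsub>?F\<^esub> (c \<odot>\<^bsub>?F\<^esub> p)"
      unfolding boole_weyl_def p
      by (rule assoc_algebra.quotient_smult[OF free_algebra_assoc_algebra ideal_bw_ideal])
         (simp_all add: type_ring_def free_algebra_ops)
    then show ?thesis
      by (simp add: p \<psi>_coset free_algebra_ops End_regular_ops bw_rep_const_mult fun_eq_iff)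
  qed
  with iso have "\<psi> \<in> algebra_iso Z2 ?B ?E"
    by (auto simp: algebra_iso_def algebra_hom_def ring_iso_def ring_hom_def boole_weyl_def
        quotient_algebra_def)
  then show "\<exists>\<psi> \<in> algebra_iso Z2 ?B ?E.
      \<forall>p \<in> carrier ?F. \<psi> (bw_ideal +>\<^bsub>?F\<^esub> p) = \<Phi> p"
    using \<psi>_coset \<Phi> by blast
qed

end
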